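(* The Grundy value $g(G)$ of the odd/odd vertex removal game played on a grid graph $G$ is either $0$ or $1$.
   Context: All graphs are finite, simple and undirected. The odd/odd vertex removal game is the following impartial two-player game. A position is a graph. A move from a graph $G$ consists of choosing a vertex $v$ of odd degree in $G$ and removing $v$ together with all edges incident to it, giving the graph $G-v$. The players alternate moves, both players have the same available moves, and a player who cannot move loses. The Grundy (Sprague-Grundy) value $g(G)$ of a position is defined recursively by $g(G)=\operatorname{mex}\{g(G-v) : v \text{ a vertex of odd degree in } G\}$, where $\operatorname{mex}(A)$ denotes the smallest nonnegative integer not in the set $A$ (so $g(G)=0$ if $G$ has no vertex of odd degree). A grid graph is a graph with vertex set $\{1,\dots,m\}\times\{1,\dots,n\}$ for some integers $m,n\ge 1$, in which $(a,b)$ and $(c,d)$ are adjacent if and only if $|a-c|+|b-d|=1$. *)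

theory Defs
  imports "Graph_Theory.Graph_Theory"
begin

text \<open>
  Finite simple undirected graphs are those satisfying the locale predicate \<^const>\<open>graph\<close>:
  finite loop-free symmetric digraphs without parallel arcs. An edge $uv$ is represented by
  the two arcs $(u,v)$ and $(v,u)$, so the degree of $v$ is the number of arcs leaving $v$
  (see \<open>out_degree_eq_card_neighbours\<close> below).
\<close>

lemma (in graph) out_degree_eq_card_neighbours:
  "out_degree G v = card {u \<in> verts G. (v, u) \<in> arcs_ends G}"
proof -
  have "inj_on (head G) (out_arcs G v)"
    using no_multi_arcs by (auto simp: inj_on_def arc_to_ends_def)
  moreover have "head G ` out_arcs G v = {u \<in> verts G. (v, u) \<in> arcs_ends G}"
    by (auto simp: arcs_ends_def arc_to_ends_def image_iff)
  ultimately show ?thesis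
    unfolding out_degree_def by (metis card_image)
qed

lemma (in graph) graph_del_vert: "graph (del_vert v)"
proof -
  interpret D: fin_digraph "del_vert v" by (rule fin_digraph_del_vert)
  have "symmetric (del_vert v)"
    unfolding symmetric_def
  proof (rule symI)
    fix x y assume "(x, y) \<in> arcs_ends (del_vert v)"
    then have xy: "(x, y) \<in> arcs_ends G" "x \<noteq> v" "y \<noteq> v"
      by (auto simp: arcs_ends_def arc_to_ends_def del_vert_simps)
    then have "(y, x) \<in> arcs_ends G"
      using sym_arcs by (auto simp: symmetric_def dest: symD)
    with xy show "(y, x) \<in> arcs_ends (del_vert v)"
      by (auto simp: arcs_ends_def arc_to_ends_def del_vert_simps)
  qed
  then show ?thesis
    using no_loops no_multi_arcs
    by unfold_locales (auto simp: del_vert_simps arc_to_ends_def)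
qed

definition odd_moves :: "('a, 'b) pre_digraph \<Rightarrow> ('a, 'b) pre_digraph set" where
  "odd_moves G = {pre_digraph.del_vert G v | v. v \<in> verts G \<and> odd (out_degree G v)}"

definition mex :: "nat set \<Rightarrow> nat" where
  "mex A = (LEAST n. n \<notin> A)"

text \<open>Only graphs are positions of the game; other digraphs get no specified value.\<close>

function grundy :: "('a, 'b) pre_digraph \<Rightarrow> nat" where
  "grundy G = (if graph G then mex (grundy ` odd_moves G) else undefined)"
  by auto
termination
proof (relation "measure (\<lambda>G. card (verts G))")
  fix G H :: "('a, 'b) pre_digraph"
  assume "graph G" and H: "H \<in> odd_moves G"
  then interpret graph G by simp
  from H obtain v where "v \<in> verts G" "H = del_vert v"
    by (auto simp: odd_moves_def)
  then show "(H, G) \<in> measure (\<lambda>G. card (verts G))"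
    using card_Diff1_less[of "verts G" v] by (simp add: del_vert_simps)
qed simp

declare grundy.simps [simp del]

lemma grundy_eq_mex:
  assumes "graph G"
  shows "grundy G =
    mex {grundy (pre_digraph.del_vert G v) | v. v \<in> verts G \<and> odd (out_degree G v)}"
  using assms by (subst grundy.simps) (auto simp: odd_moves_def intro!: arg_cong[where f = mex])

definition grid_graph :: "nat \<Rightarrow> nat \<Rightarrow> (nat \<times> nat, (nat \<times> nat) \<times> (nat \<times> nat)) pre_digraph" where
  "grid_graph m n = with_proj
    \<lparr> pverts = {1..m} \<times> {1..n},
      parcs = {((a, b), (c, d)) | a b c d.
        (a, b) \<in> {1..m} \<times> {1..n} \<and> (c, d) \<in> {1..m} \<times> {1..n} \<and>
        \<bar>int a - int c\<bar> + \<bar>int b - int d\<bar> = 1} \<rparr>"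

lemma graph_grid_graph: "graph (grid_graph m n)"
proof -
  have "finite (arcs (grid_graph m n))"
    by (rule finite_subset[of _ "({1..m} \<times> {1..n}) \<times> ({1..m} \<times> {1..n})"])
      (auto simp: grid_graph_def)
  then show ?thesis
    by unfold_locales
      (auto simp: grid_graph_def arc_to_ends_def symmetric_def sym_def abs_minus_commute)
qed

end

theory Submission
  imports Defs
begin

text \<open>
  In a bipartite graph the edges are counted by the degrees on one side, so a bipartite graph
  without odd vertices has an even number of edges. Every move removes an odd number of edges,
  hence the outcome does not depend on the play and the Grundy value is the parity of the number
  of edges.
\<close>

text \<open>Without parallel arcs an arc is determined by its pair of ends, and by symmetry swapping
  the pairs turns the arcs into \<open>v\<close> into the arcs out of \<open>v\<close>.\<close>

lemma (in graph) in_degree_eq_out_degree: "in_degree G v = out_degree G v"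
proof -
  have inj: "inj_on (arc_to_ends G) (arcs G)"
    using no_multi_arcs by (auto simp: inj_on_def)
  have "card (in_arcs G v) = card (arc_to_ends G ` in_arcs G v)"
    by (rule card_image[symmetric]) (rule inj_on_subset[OF inj], auto)
  also have "\<dots> = card (prod.swap ` arc_to_ends G ` in_arcs G v)"
    by (rule card_image[symmetric]) (auto intro!: inj_onI simp: prod_eq_iff)
  also have "prod.swap ` arc_to_ends G ` in_arcs G v = arc_to_ends G ` out_arcs G v"
  proof (intro equalityI subsetI)
    fix p assume "p \<in> prod.swap ` arc_to_ends G ` in_arcs G v"
    then obtain a where "a \<in> arcs G" "head G a = v" "p = (v, tail G a)"
      by (auto simp: arc_to_ends_def)
    moreover from \<open>a \<in> arcs G\<close> obtain b where "b \<in> arcs G" "tail G a = head G b" "head G a = tail G b"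
      using sym_arcs unfolding symmetric_conv by blast
    ultimately show "p \<in> arc_to_ends G ` out_arcs G v"
      by (intro image_eqI[of _ _ b]) (simp_all add: arc_to_ends_def)
  next
    fix p assume "p \<in> arc_to_ends G ` out_arcs G v"
    then obtain a where "a \<in> arcs G" "tail G a = v" "p = (v, head G a)"
      by (auto simp: arc_to_ends_def)
    moreover from \<open>a \<in> arcs G\<close> obtain b where "b \<in> arcs G" "tail G a = head G b" "head G a = tail G b"
      using sym_arcs unfolding symmetric_conv by blast
    ultimately show "p \<in> prod.swap ` arc_to_ends G ` in_arcs G v"
      unfolding image_image by (intro image_eqI[of _ _ b]) (simp_all add: arc_to_ends_def)
  qed
  also have "card \<dots> = card (out_arcs G v)"
    by (rule card_image) (rule inj_on_subset[OF inj], auto)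
  finally show ?thesis by (simp add: in_degree_def out_degree_def)
qed

text \<open>If \<open>X\<close> is one side of a bipartition, exactly one of the two arcs of each
  edge starts in \<open>X\<close>, so the left-hand side is the number of edges; grouping these arcs
  by tail gives the degree sum over that side.\<close>

lemma (in graph) card_arcs_from:
  "card {a \<in> arcs G. tail G a \<in> X} = (\<Sum>v \<in> verts G \<inter> X. out_degree G v)"
proof -
  have "{a \<in> arcs G. tail G a \<in> X} = (\<Union>v \<in> verts G \<inter> X. out_arcs G v)"
    by auto
  then show ?thesis
    unfolding out_degree_def by (simp only:) (rule card_UN_disjoint, auto)
qed

text \<open>The assumption makes \<open>X\<close> and its complement a bipartition. Of the arcs
  starting in \<open>X\<close>, deleting \<open>v\<close> destroys those leaving \<open>v\<close> if
  \<open>v\<close> lies in \<open>X\<close>, and those entering \<open>v\<close> otherwise; both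
  families have the size of the degree.\<close>

lemma (in graph) card_arcs_from_del_vert:
  assumes "\<And>a. a \<in> arcs G \<Longrightarrow> tail G a \<in> X \<longleftrightarrow> head G a \<notin> X"
  shows "card {a \<in> arcs G. tail G a \<in> X} =
    card {a \<in> arcs (del_vert v). tail G a \<in> X} + out_degree G v"
proof -
  have "{a \<in> arcs G. tail G a \<in> X} = {a \<in> arcs (del_vert v). tail G a \<in> X} \<union>
      (if v \<in> X then out_arcs G v else in_arcs G v)"
    using assms by (auto simp: del_vert_simps)
  also have "card \<dots> = card {a \<in> arcs (del_vert v). tail G a \<in> X} +
      card (if v \<in> X then out_arcs G v else in_arcs G v)"
    by (rule card_Un_disjoint) (auto simp: del_vert_simps)
  also have "card (if v \<in> X then out_arcs G v else in_arcs G v) = out_degree G v"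
    using in_degree_eq_out_degree[of v] by (simp add: in_degree_def out_degree_def)
  finally show ?thesis .
qed

lemma mex_empty: "mex {} = 0"
  by (simp add: mex_def)

lemma mex_singleton: "mex {k} = (if k = 0 then 1 else 0)"
  by (auto simp: mex_def intro!: Least_equality)

text \<open>Grid graphs are not closed under moves, but bipartite graphs are. The set
  \<open>X\<close> may contain non-vertices, so the same \<open>X\<close> serves every later
  position.\<close>

theorem grundy_bipartite:
  assumes "graph G" and "\<And>a. a \<in> arcs G \<Longrightarrow> tail G a \<in> X \<longleftrightarrow> head G a \<notin> X"
  shows "grundy G = card {a \<in> arcs G. tail G a \<in> X} mod 2"
  using assms
proof (induction "card (verts G)" arbitrary: G rule: less_induct)
  case less
  interpret graph G by fact
  let ?e = "card {a \<in> arcs G. tail G a \<in> X}"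
  let ?V = "{v \<in> verts G. odd (out_degree G v)}"
  \<comment> \<open>A move removes an odd number of edges, so all options have the same value, the
    opposite parity of \<open>?e\<close>.\<close>
  have option_value: "grundy (del_vert v) = (?e + 1) mod 2" if "v \<in> ?V" for v
  proof -
    have "card (verts (del_vert v)) < card (verts G)"
      using that card_Diff1_less[of "verts G" v] by (simp add: del_vert_simps)
    then have "grundy (del_vert v) = card {a \<in> arcs (del_vert v). tail (del_vert v) a \<in> X} mod 2"
      by (rule less.hyps) (use less.prems graph_del_vert in \<open>auto simp: del_vert_simps\<close>)
    moreover have "?e = card {a \<in> arcs (del_vert v). tail G a \<in> X} + out_degree G v"
      using less.prems(2) by (rule card_arcs_from_del_vert)
    ultimately show ?thesis
      using that by (auto simp: del_vert_simps mod_2_eq_odd)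
  qed
  show ?case
  proof (cases "?V = {}")
    case True
    \<comment> \<open>Every degree in the sum over one side is even.\<close>
    then have "even ?e"
      unfolding card_arcs_from by (intro dvd_sum) auto
    moreover from True have "{grundy (del_vert v) | v. v \<in> verts G \<and> odd (out_degree G v)} = {}"
      by blast
    ultimately show ?thesis
      unfolding grundy_eq_mex[OF less.prems(1)] by (simp only: mex_empty even_iff_mod_2_eq_zero)
  next
    case False
    have "{grundy (del_vert v) | v. v \<in> verts G \<and> odd (out_degree G v)} = (\<lambda>v. grundy (del_vert v)) ` ?V"
      by blast
    also have "\<dots> = (\<lambda>_. (?e + 1) mod 2) ` ?V"
      using option_value by (rule image_cong[OF refl])
    also have "\<dots> = {(?e + 1) mod 2}"
      using False unfolding image_constant_conv by (rule if_not_P)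
    \<comment> \<open>Since \<open>?V\<close> is nonempty, the set of option values is the singleton
      of the opposite parity, and its mex is the parity of \<open>?e\<close>.\<close>
    finally show ?thesis
      by (simp add: grundy_eq_mex[OF less.prems(1)] mex_singleton mod_2_eq_odd)
  qed
qed

theorem corollary2:
  fixes m n :: nat
  assumes "m \<ge> 1" and "n \<ge> 1"
  shows "grundy (grid_graph m n) = 0 \<or> grundy (grid_graph m n) = 1"
proof -
  \<comment> \<open>The checkerboard colouring: a unit step changes the parity of the coordinate
    sum.\<close>
  let ?X = "{(a, b). even (a + b :: nat)}"
  have "tail (grid_graph m n) e \<in> ?X \<longleftrightarrow> head (grid_graph m n) e \<notin> ?X"
    if "e \<in> arcs (grid_graph m n)" for e
  proof -
    obtain a b c d where e: "e = ((a, b), (c, d))" and "\<bar>int a - int c\<bar> + \<bar>int b - int d\<bar> = 1"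
      using \<open>e \<in> arcs (grid_graph m n)\<close> by (auto simp: grid_graph_def)
    then have "c = a \<and> (d = b + 1 \<or> b = d + 1) \<or> d = b \<and> (c = a + 1 \<or> a = c + 1)"
      by linarith
    then have "even (a + b) \<longleftrightarrow> odd (c + d)" by auto
    then show ?thesis by (simp add: e grid_graph_def)
  qed
  from grundy_bipartite[OF graph_grid_graph this] show ?thesis
    by (simp only: mod_2_eq_odd) (simp add: of_bool_def)
qed

end
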